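(* For every norm $\alpha_0$ on $V$, the metric space $(\mathscr N_{\alpha_0}(V),d_\infty)$ is hyperconvex. Explicitly, let $\{B(\alpha_i,r_i)\}_{i\in I}$ be any nonempty family of closed balls in $\mathscr N_{\alpha_0}(V)$ (with $\alpha_i\in\mathscr N_{\alpha_0}(V)$, $r_i\geq 0$) satisfying $$d_\infty(\alpha_i,\alpha_j)\le r_i+r_j\qquad(i,j\in I).$$ Then $$\beta(v)=\sup_{i\in I}e^{-r_i}\alpha_i(v)\qquad (v\in V)$$ is a norm belonging to every ball $B(\alpha_i,r_i)$. Consequently $(\mathscr N_{\alpha_0}(V),d_\infty)$ is an injective metric space.
   Context: Let $F$ and $E$ be finite extensions of $\mathbb Q_p$, with a fixed (non-Archimedean, nontrivial) absolute value $|\cdot|$ on $E$. Let $\mathbb G$ be a reductive group over $F$ and $G=\mathbb G(F)$. Let $\pi_{\mathrm{sm}}$ be a smooth admissible $E$-representation of $G$, let $\sigma_{\mathrm{alg}}$ be a finite-dimensional algebraic $E$-representation of $\operatorname{Res}_{F/\mathbb Q_p}\mathbb G$ (viewed as a representation of $G$), and put $V=\pi_{\mathrm{sm}}\otimes_E\sigma_{\mathrm{alg}}$ with the diagonal $G$-action. A norm on $V$ is a function $\alpha:V\to\mathbb R_{\ge0}$ with $\alpha(\lambda v)=|\lambda|\alpha(v)$, $\alpha(v+w)\le\max\{\alpha(v),\alpha(w)\}$ for $\lambda\in E$, $v,w\in V$, and $\alpha(v)=0\Rightarrow v=0$. For norms $\alpha,\beta$ put $d_\infty(\alpha,\beta)=\sup_{v\in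 V\setminus\{0\}}\left|\log\frac{\alpha(v)}{\beta(v)}\right|\in[0,+\infty]$. The finite-distance component of $\alpha_0$ is $\mathscr N_{\alpha_0}(V)=\{\alpha:\ d_\infty(\alpha,\alpha_0)<\infty\}$; $d_\infty$ restricts to a genuine metric on it. $B(\alpha,r)$ is the closed ball of radius $r$ about $\alpha$ in this metric space. A metric space $(X,d)$ is hyperconvex if every family of closed balls $B(x_i,r_i)$ with $d(x_i,x_j)\le r_i+r_j$ for all $i,j$ has a common point. It is injective if every 1-Lipschitz map $A\to X$ from a subset $A$ of a metric space $Y$ extends to a 1-Lipschitz map $Y\to X$. *)

theory Defs
  imports
    "HOL-Analysis.Analysis"
    "HOL-Library.Poly_Mapping"
    "HOL-Algebra.Algebraic_Closure_Type"
begin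

section \<open>Absolute values, p-adic numbers and their finite extensions\<close>

definition nonarch_abs :: "('k::field \<Rightarrow> real) \<Rightarrow> bool" where
  "nonarch_abs v \<longleftrightarrow>
     (\<forall>x. 0 \<le> v x) \<and> (\<forall>x. v x = 0 \<longleftrightarrow> x = 0) \<and>
     (\<forall>x y. v (x * y) = v x * v y) \<and> (\<forall>x y. v (x + y) \<le> max (v x) (v y))"

definition nontrivial_abs :: "('k::field \<Rightarrow> real) \<Rightarrow> bool" where
  "nontrivial_abs v \<longleftrightarrow> (\<exists>x. x \<noteq> 0 \<and> v x \<noteq> 1)"

definition padic_abs_rat :: "nat \<Rightarrow> rat \<Rightarrow> real" where
  "padic_abs_rat p q =
     (if q = 0 then 0
      else real p powi (int (multiplicity (int p) (snd (quotient_of q)))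
                      - int (multiplicity (int p) (fst (quotient_of q)))))"

text \<open>
  There is no library type for the \<open>p\<close>-adic numbers. We say that a field with an absolute value
  \<^emph>\<open>is\<close> the field of \<open>p\<close>-adic numbers if it is a completion of the rationals with respect
  to the \<open>p\<close>-adic absolute value; this determines it up to unique isometric isomorphism.
\<close>
definition is_padic_field :: "nat \<Rightarrow> ('q::field_char_0 \<Rightarrow> real) \<Rightarrow> bool" where
  "is_padic_field p v \<longleftrightarrow>
     Factorial_Ring.prime p \<and> nonarch_abs v \<and>
     (\<forall>r. v (of_rat r) = padic_abs_rat p r) \<and>
     (\<forall>x. \<forall>\<epsilon>>0. \<exists>r. v (x - of_rat r) < \<epsilon>) \<and>
     Metric_space.mcomplete UNIV (\<lambda>x y. v (x - y))"

definition field_embedding :: "('k::field \<Rightarrow> 'l::field) \<Rightarrow> bool" where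
  "field_embedding \<phi> \<longleftrightarrow>
     \<phi> 1 = 1 \<and> (\<forall>x y. \<phi> (x + y) = \<phi> x + \<phi> y) \<and> (\<forall>x y. \<phi> (x * y) = \<phi> x * \<phi> y)"

definition finite_field_ext :: "('k::field \<Rightarrow> 'l::field) \<Rightarrow> bool" where
  "finite_field_ext \<iota> \<longleftrightarrow>
     field_embedding \<iota> \<and> (\<exists>B. finite_dimensional_vector_space (\<lambda>a x. \<iota> a * x) B)"

section \<open>Linear algebraic groups\<close>

type_synonym ('x, 'a) mvpoly = "('x \<Rightarrow>\<^sub>0 nat) \<Rightarrow>\<^sub>0 'a"

definition poly_eval ::
  "('a::field \<Rightarrow> 'b::field) \<Rightarrow> ('x, 'a) mvpoly \<Rightarrow> ('x \<Rightarrow> 'b) \<Rightarrow> 'b" where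
  "poly_eval \<phi> P z =
     (\<Sum>m\<in>Poly_Mapping.keys P. \<phi> (Poly_Mapping.lookup P m) *
        (\<Prod>x\<in>Poly_Mapping.keys m. z x ^ Poly_Mapping.lookup m x))"

definition poly_vars :: "('x, 'a::zero) mvpoly \<Rightarrow> 'x set" where
  "poly_vars P = (\<Union>m\<in>Poly_Mapping.keys P. Poly_Mapping.keys m)"

definition GL :: "('k::field ^ 'n ^ 'n) monoid" where
  "GL = \<lparr>carrier = {g. invertible g}, mult = (**), one = mat 1\<rparr>"

text \<open>
  A linear algebraic group over a field \<open>k\<close> of characteristic zero is given by a set \<open>P\<close>
  of polynomials over \<open>k\<close> in the matrix entries, cutting out a closed subgroup of \<open>GL\<^sub>n\<close>.
  \<open>points \<phi> P\<close> is its group of points in the field \<open>l\<close>, for a field embedding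
  \<open>\<phi>\<close> from \<open>k\<close> to \<open>l\<close>.
\<close>
definition points ::
  "('k::field \<Rightarrow> 'l::field) \<Rightarrow> ('n \<times> 'n, 'k) mvpoly set \<Rightarrow> ('l ^ 'n ^ 'n) set" where
  "points \<phi> P = {g. invertible g \<and> (\<forall>f\<in>P. poly_eval \<phi> f (\<lambda>(i, j). g $ i $ j) = 0)}"

definition geom_points ::
  "('n \<times> 'n, 'k::field) mvpoly set \<Rightarrow> ('k alg_closure ^ 'n ^ 'n) set" where
  "geom_points P = points to_ac P"

definition linear_algebraic_group :: "('n::finite \<times> 'n, 'k::field) mvpoly set \<Rightarrow> bool" where
  "linear_algebraic_group P \<longleftrightarrow> subgroup (geom_points P) GL"

definition zariski_closed_GL :: "('k::field ^ 'n ^ 'n) set \<Rightarrow> bool" where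
  "zariski_closed_GL A \<longleftrightarrow> (\<exists>Q. A = points id Q)"

definition zariski_connected :: "('k::field ^ 'n ^ 'n) set \<Rightarrow> bool" where
  "zariski_connected H \<longleftrightarrow>
     (\<forall>A B. zariski_closed_GL A \<and> zariski_closed_GL B \<and> A \<union> B = H \<and> A \<inter> B = {}
        \<longrightarrow> A = {} \<or> B = {})"

definition unipotent_matrix :: "'k::field ^ 'n ^ 'n \<Rightarrow> bool" where
  "unipotent_matrix g \<longleftrightarrow> (\<exists>k. ((\<lambda>A. A ** (g - mat 1)) ^^ k) (mat 1) = 0)"

text \<open>
  The unipotent radical is trivial: over the algebraic closure there is no nontrivial closed
  connected normal unipotent subgroup. The group itself is not required to be connected.
\<close>
definition reductive_group :: "('n::finite \<times> 'n, 'k::field) mvpoly set \<Rightarrow> bool" where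
  "reductive_group P \<longleftrightarrow>
     linear_algebraic_group P \<and>
     (\<forall>N. zariski_closed_GL N \<and> normal N (GL\<lparr>carrier := geom_points P\<rparr>) \<and>
          zariski_connected N \<and> (\<forall>g\<in>N. unipotent_matrix g) \<longrightarrow> N = {mat 1})"

section \<open>Representations\<close>

definition is_representation ::
  "('e::field \<Rightarrow> 'v::ab_group_add \<Rightarrow> 'v) \<Rightarrow> ('k::field ^ 'n ^ 'n) set \<Rightarrow>
   ('k ^ 'n ^ 'n \<Rightarrow> 'v \<Rightarrow> 'v) \<Rightarrow> bool" where
  "is_representation sc G \<rho> \<longleftrightarrow>
     vector_space sc \<and>
     (\<forall>g\<in>G. Vector_Spaces.linear sc sc (\<rho> g)) \<and>
     (\<forall>v. \<rho> (mat 1) v = v) \<and>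
     (\<forall>g\<in>G. \<forall>h\<in>G. \<forall>v. \<rho> (g ** h) v = \<rho> g (\<rho> h v))"

definition matrix_dist ::
  "('k::field \<Rightarrow> real) \<Rightarrow> 'k ^ 'n ^ 'n \<Rightarrow> 'k ^ 'n ^ 'n \<Rightarrow> real" where
  "matrix_dist v g h = Max (range (\<lambda>(i, j). v (g $ i $ j - h $ i $ j)))"

abbreviation group_topology ::
  "('k::field \<Rightarrow> real) \<Rightarrow> ('k ^ 'n ^ 'n) set \<Rightarrow> ('k ^ 'n ^ 'n) topology" where
  "group_topology v G \<equiv> Metric_space.mtopology G (matrix_dist v)"

definition smooth_representation ::
  "('f::field \<Rightarrow> real) \<Rightarrow> ('e::field \<Rightarrow> 'v::ab_group_add \<Rightarrow> 'v) \<Rightarrow> ('f ^ 'n ^ 'n) set \<Rightarrow>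
   ('f ^ 'n ^ 'n \<Rightarrow> 'v \<Rightarrow> 'v) \<Rightarrow> bool" where
  "smooth_representation absF sc G \<pi> \<longleftrightarrow>
     is_representation sc G \<pi> \<and>
     (\<forall>v. openin (group_topology absF G) {g\<in>G. \<pi> g v = v})"

definition admissible_representation ::
  "('f::field \<Rightarrow> real) \<Rightarrow> ('e::field \<Rightarrow> 'v::ab_group_add \<Rightarrow> 'v) \<Rightarrow> ('f ^ 'n ^ 'n) set \<Rightarrow>
   ('f ^ 'n ^ 'n \<Rightarrow> 'v \<Rightarrow> 'v) \<Rightarrow> bool" where
  "admissible_representation absF sc G \<pi> \<longleftrightarrow>
     (\<forall>K. subgroup K (GL\<lparr>carrier := G\<rparr>) \<and> openin (group_topology absF G) K \<and>
          compactin (group_topology absF G) K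
        \<longrightarrow> (\<exists>B. finite B \<and> {v. \<forall>g\<in>K. \<pi> g v = v} \<subseteq> Modules.module.span sc B))"

text \<open>
  Let \<open>F\<close> and \<open>E\<close> be extensions of \<open>k\<close> via \<open>iF\<close> and \<open>iE\<close>, with \<open>F\<close> finite over \<open>k\<close> and \<open>k\<close> of
  characteristic zero. Over the algebraic closure of \<open>E\<close>, the restriction of scalars from \<open>F\<close>
  to \<open>k\<close> of the group defined by \<open>P\<close> is the product of the conjugates of that group under the
  \<open>k\<close>-embeddings \<open>\<tau>\<close> of \<open>F\<close> into the algebraic closure of \<open>E\<close>. Its \<open>E\<close>-structure is recorded by
  the action of the automorphisms over \<open>E\<close> (\<open>galois_twist\<close>), which also permute the factors.
\<close>
definition embeddings ::
  "('k::field \<Rightarrow> 'f::field) \<Rightarrow> ('k \<Rightarrow> 'e::field) \<Rightarrow> ('f \<Rightarrow> 'e alg_closure) set" where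
  "embeddings iF iE = {\<tau>. field_embedding \<tau> \<and> (\<forall>x. \<tau> (iF x) = to_ac (iE x))}"

definition res_points ::
  "('k::field \<Rightarrow> 'f::field) \<Rightarrow> ('k \<Rightarrow> 'e::field) \<Rightarrow> ('n \<times> 'n, 'f) mvpoly set \<Rightarrow>
   (('f \<Rightarrow> 'e alg_closure) \<Rightarrow> 'e alg_closure ^ 'n ^ 'n) set" where
  "res_points iF iE P = (\<Pi>\<^sub>E \<tau>\<in>embeddings iF iE. points \<tau> P)"

definition res_mult ::
  "('k::field \<Rightarrow> 'f::field) \<Rightarrow> ('k \<Rightarrow> 'e::field) \<Rightarrow>
   (('f \<Rightarrow> 'e alg_closure) \<Rightarrow> 'e alg_closure ^ 'n ^ 'n) \<Rightarrow>
   (('f \<Rightarrow> 'e alg_closure) \<Rightarrow> 'e alg_closure ^ 'n ^ 'n) \<Rightarrow>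
   (('f \<Rightarrow> 'e alg_closure) \<Rightarrow> 'e alg_closure ^ 'n ^ 'n)" where
  "res_mult iF iE g h = (\<lambda>\<tau>\<in>embeddings iF iE. g \<tau> ** h \<tau>)"

text \<open>The inclusion of the \<open>F\<close>-points of the group, i.e. of the \<open>k\<close>-points of its restriction.\<close>
definition res_incl ::
  "('k::field \<Rightarrow> 'f::field) \<Rightarrow> ('k \<Rightarrow> 'e::field) \<Rightarrow> 'f ^ 'n ^ 'n \<Rightarrow>
   (('f \<Rightarrow> 'e alg_closure) \<Rightarrow> 'e alg_closure ^ 'n ^ 'n)" where
  "res_incl iF iE g = (\<lambda>\<tau>\<in>embeddings iF iE. map_matrix \<tau> g)"

definition galois_group :: "('e::field alg_closure \<Rightarrow> 'e alg_closure) set" where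
  "galois_group = {\<gamma>. bij \<gamma> \<and> field_embedding \<gamma> \<and> (\<forall>a. \<gamma> (to_ac a) = to_ac a)}"

definition galois_twist ::
  "('k::field \<Rightarrow> 'f::field) \<Rightarrow> ('k \<Rightarrow> 'e::field) \<Rightarrow> ('e alg_closure \<Rightarrow> 'e alg_closure) \<Rightarrow>
   (('f \<Rightarrow> 'e alg_closure) \<Rightarrow> 'e alg_closure ^ 'n ^ 'n) \<Rightarrow>
   (('f \<Rightarrow> 'e alg_closure) \<Rightarrow> 'e alg_closure ^ 'n ^ 'n)" where
  "galois_twist iF iE \<gamma> g = (\<lambda>\<tau>\<in>embeddings iF iE. map_matrix \<gamma> (g (inv_into UNIV \<gamma> \<circ> \<tau>)))"

text \<open>Regular functions: polynomials in the entries and the inverse determinants.\<close>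
definition res_regular ::
  "('k::field \<Rightarrow> 'f::field) \<Rightarrow> ('k \<Rightarrow> 'e::field) \<Rightarrow> ('n::finite \<times> 'n, 'f) mvpoly set \<Rightarrow>
   ((('f \<Rightarrow> 'e alg_closure) \<Rightarrow> 'e alg_closure ^ 'n ^ 'n) \<Rightarrow> 'e alg_closure) \<Rightarrow> bool" where
  "res_regular iF iE P u \<longleftrightarrow>
     (\<exists>(Q :: (('f \<Rightarrow> 'e alg_closure) \<times> 'n \<times> 'n, 'e alg_closure) mvpoly) N.
        poly_vars Q \<subseteq> embeddings iF iE \<times> UNIV \<and>
        (\<forall>g\<in>res_points iF iE P.
           u g = poly_eval id Q (\<lambda>(\<tau>, i, j). g \<tau> $ i $ j) /
                 (\<Prod>\<tau>\<in>embeddings iF iE. det (g \<tau>)) ^ N))"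

text \<open>
  A finite-dimensional algebraic \<open>E\<close>-representation of the restriction of scalars, viewed as a
  representation \<open>\<sigma>\<close> of the \<open>F\<close>-points \<open>points id P\<close>: in some finite basis \<open>B\<close>, \<open>\<sigma>\<close> is the
  restriction to these points of a homomorphism \<open>M\<close> of algebraic groups from the restriction
  of scalars to \<open>GL\<^sub>B\<close>, defined over \<open>E\<close> (i.e. Galois-equivariant).
\<close>
definition algebraic_representation ::
  "('k::field \<Rightarrow> 'f::field) \<Rightarrow> ('k \<Rightarrow> 'e::field) \<Rightarrow> ('n::finite \<times> 'n, 'f) mvpoly set \<Rightarrow>
   ('e \<Rightarrow> 's::ab_group_add \<Rightarrow> 's) \<Rightarrow> ('f ^ 'n ^ 'n \<Rightarrow> 's \<Rightarrow> 's) \<Rightarrow> bool" where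
  "algebraic_representation iF iE P sc \<sigma> \<longleftrightarrow>
     is_representation sc (points id P) \<sigma> \<and>
     (\<exists>B. finite_dimensional_vector_space sc B \<and>
       (\<exists>M :: (('f \<Rightarrow> 'e alg_closure) \<Rightarrow> 'e alg_closure ^ 'n ^ 'n) \<Rightarrow> 's \<Rightarrow> 's \<Rightarrow> 'e alg_closure.
         (\<forall>b\<in>B. \<forall>c\<in>B. res_regular iF iE P (\<lambda>g. M g b c)) \<and>
         (\<forall>b\<in>B. \<forall>c\<in>B. M (res_incl iF iE (mat 1)) b c = (if b = c then 1 else 0)) \<and>
         (\<forall>g\<in>res_points iF iE P. \<forall>h\<in>res_points iF iE P. \<forall>b\<in>B. \<forall>c\<in>B.
            M (res_mult iF iE g h) b c = (\<Sum>d\<in>B. M g b d * M h d c)) \<and>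
         (\<forall>\<gamma>\<in>galois_group. \<forall>g\<in>res_points iF iE P. \<forall>b\<in>B. \<forall>c\<in>B.
            M (galois_twist iF iE \<gamma> g) b c = \<gamma> (M g b c)) \<and>
         (\<forall>g\<in>points id P. \<forall>c\<in>B. \<exists>a. \<sigma> g c = (\<Sum>b\<in>B. sc (a b) b) \<and>
            (\<forall>b\<in>B. M (res_incl iF iE g) b c = to_ac (a b)))))"

text \<open>
  \<open>V\<close> with the map \<open>t\<close> is the tensor product of \<open>X\<close> and \<open>Y\<close>: the linear map from the free vector
  space on \<open>X \<times> Y\<close> to \<open>V\<close> induced by \<open>t\<close> is surjective and its kernel is the span of the usual
  relations.
\<close>
definition tensor_relations ::
  "('e::field \<Rightarrow> 'x::ab_group_add \<Rightarrow> 'x) \<Rightarrow> ('e \<Rightarrow> 'y::ab_group_add \<Rightarrow> 'y) \<Rightarrow>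
   (('x \<times> 'y) \<Rightarrow>\<^sub>0 'e) set" where
  "tensor_relations sX sY =
     (let \<delta> = (\<lambda>x y. Poly_Mapping.single (x, y) (1::'e)) in
       {\<delta> (x + x') y - \<delta> x y - \<delta> x' y | x x' y. True} \<union>
       {\<delta> x (y + y') - \<delta> x y - \<delta> x y' | x y y'. True} \<union>
       {\<delta> (sX a x) y - Poly_Mapping.single (x, y) a | a x y. True} \<union>
       {\<delta> x (sY a y) - Poly_Mapping.single (x, y) a | a x y. True})"

definition free_extension ::
  "('e::field \<Rightarrow> 'w::ab_group_add \<Rightarrow> 'w) \<Rightarrow> ('x \<Rightarrow> 'y \<Rightarrow> 'w) \<Rightarrow> (('x \<times> 'y) \<Rightarrow>\<^sub>0 'e) \<Rightarrow> 'w" where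
  "free_extension sV t f =
     (\<Sum>(x, y)\<in>Poly_Mapping.keys f. sV (Poly_Mapping.lookup f (x, y)) (t x y))"

definition is_tensor_product ::
  "('e::field \<Rightarrow> 'x::ab_group_add \<Rightarrow> 'x) \<Rightarrow> ('e \<Rightarrow> 'y::ab_group_add \<Rightarrow> 'y) \<Rightarrow>
   ('e \<Rightarrow> 'w::ab_group_add \<Rightarrow> 'w) \<Rightarrow> ('x \<Rightarrow> 'y \<Rightarrow> 'w) \<Rightarrow> bool" where
  "is_tensor_product sX sY sV t \<longleftrightarrow>
     vector_space sX \<and> vector_space sY \<and> vector_space sV \<and>
     surj (free_extension sV t) \<and>
     {f. free_extension sV t f = 0} =
       Modules.module.span (\<lambda>a. Poly_Mapping.map ((*) a)) (tensor_relations sX sY)"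

definition diagonal_action ::
  "('e::field \<Rightarrow> 'w::ab_group_add \<Rightarrow> 'w) \<Rightarrow> ('x \<Rightarrow> 'y \<Rightarrow> 'w) \<Rightarrow> ('f::field ^ 'n ^ 'n) set \<Rightarrow>
   ('f ^ 'n ^ 'n \<Rightarrow> 'x \<Rightarrow> 'x) \<Rightarrow> ('f ^ 'n ^ 'n \<Rightarrow> 'y \<Rightarrow> 'y) \<Rightarrow> ('f ^ 'n ^ 'n \<Rightarrow> 'w \<Rightarrow> 'w) \<Rightarrow> bool" where
  "diagonal_action sV t G \<pi> \<sigma> \<rho> \<longleftrightarrow>
     is_representation sV G \<rho> \<and> (\<forall>g\<in>G. \<forall>x y. \<rho> g (t x y) = t (\<pi> g x) (\<sigma> g y))"

section \<open>Norms\<close>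

definition is_norm ::
  "('e::field \<Rightarrow> real) \<Rightarrow> ('e \<Rightarrow> 'w::ab_group_add \<Rightarrow> 'w) \<Rightarrow> ('w \<Rightarrow> real) \<Rightarrow> bool" where
  "is_norm absE sc \<alpha> \<longleftrightarrow>
     (\<forall>v. 0 \<le> \<alpha> v) \<and>
     (\<forall>c v. \<alpha> (sc c v) = absE c * \<alpha> v) \<and>
     (\<forall>v w. \<alpha> (v + w) \<le> max (\<alpha> v) (\<alpha> w)) \<and>
     (\<forall>v. \<alpha> v = 0 \<longrightarrow> v = 0)"

text \<open>The supremum is taken in \<open>[0,\<infinity>]\<close>, so that it is \<open>0\<close> if the space is zero.\<close>
definition d_infty :: "('w::zero \<Rightarrow> real) \<Rightarrow> ('w \<Rightarrow> real) \<Rightarrow> ennreal" where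
  "d_infty \<alpha> \<beta> = (SUP v\<in>UNIV - {0}. ennreal \<bar>ln (\<alpha> v / \<beta> v)\<bar>)"

definition norm_component ::
  "('e::field \<Rightarrow> real) \<Rightarrow> ('e \<Rightarrow> 'w::ab_group_add \<Rightarrow> 'w) \<Rightarrow> ('w \<Rightarrow> real) \<Rightarrow> ('w \<Rightarrow> real) set" where
  "norm_component absE sc \<alpha>\<^sub>0 = {\<alpha>. is_norm absE sc \<alpha> \<and> d_infty \<alpha> \<alpha>\<^sub>0 < \<infinity>}"

definition norm_dist :: "('w::zero \<Rightarrow> real) \<Rightarrow> ('w \<Rightarrow> real) \<Rightarrow> real" where
  "norm_dist \<alpha> \<beta> = enn2real (d_infty \<alpha> \<beta>)"

section \<open>Hyperconvex and injective metric spaces\<close>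

text \<open>
  A family of closed balls is represented by the set of its (centre, radius) pairs; repeated
  members are irrelevant for both the hypothesis and the conclusion.
\<close>
definition hyperconvex_space :: "'a set \<Rightarrow> ('a \<Rightarrow> 'a \<Rightarrow> real) \<Rightarrow> bool" where
  "hyperconvex_space S d \<longleftrightarrow>
     Metric_space S d \<and>
     (\<forall>\<B> :: ('a \<times> real) set.
        (\<forall>(x, r)\<in>\<B>. x \<in> S \<and> 0 \<le> r) \<and>
        (\<forall>(x, r)\<in>\<B>. \<forall>(y, s)\<in>\<B>. d x y \<le> r + s)
        \<longrightarrow> (\<exists>z\<in>S. \<forall>(x, r)\<in>\<B>. z \<in> Metric_space.mcball S d x r))"

definition one_lipschitz_on ::
  "'y set \<Rightarrow> ('y \<Rightarrow> 'y \<Rightarrow> real) \<Rightarrow> ('a \<Rightarrow> 'a \<Rightarrow> real) \<Rightarrow> ('y \<Rightarrow> 'a) \<Rightarrow> bool" where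
  "one_lipschitz_on A dY d f \<longleftrightarrow> (\<forall>x\<in>A. \<forall>y\<in>A. d (f x) (f y) \<le> dY x y)"

text \<open>
  The test spaces \<open>Y\<close> are all metric spaces with points in the type \<open>'y\<close>; a statement that holds
  for a free type variable \<open>'y\<close> covers all metric spaces.
\<close>
definition injective_space :: "'y itself \<Rightarrow> 'a set \<Rightarrow> ('a \<Rightarrow> 'a \<Rightarrow> real) \<Rightarrow> bool" where
  "injective_space TY S d \<longleftrightarrow>
     Metric_space S d \<and>
     (\<forall>(Y :: 'y set) dY A f.
        Metric_space Y dY \<and> A \<subseteq> Y \<and> f \<in> A \<rightarrow> S \<and> one_lipschitz_on A dY d f
        \<longrightarrow> (\<exists>g. g \<in> Y \<rightarrow> S \<and> one_lipschitz_on Y dY d g \<and> (\<forall>x\<in>A. g x = f x)))"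

end

theory Submission
  imports Defs
begin

text \<open>
  The theorem is a statement about norms on a vector space over a field with a non-Archimedean
  absolute value, and it rests on the order of such norms.

  Between norms, \<open>d_infty \<alpha> \<beta> \<le> r\<close> says that \<open>\<alpha> \<le> exp r * \<beta>\<close> and \<open>\<beta> \<le> exp r * \<alpha>\<close> pointwise
  (\<open>d_infty_le_iff\<close>), so the sup distance is an order-theoretic notion, like the sup metric on
  bounded functions. In this form the condition \<open>d_infty (\<alpha> i) (\<alpha> j) \<le> r i + r j\<close> reads
  \<open>exp (- r i) * \<alpha> i \<le> exp (r j) * \<alpha> j\<close>: the lower envelope of each ball lies below the upper
  envelope of every ball. The pointwise supremum \<open>\<beta>\<close> of the lower envelopes is therefore finite and
  squeezed between the two envelopes of each ball. It is again a norm (\<open>is_norm_sup_envelope\<close>): the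
  ultrametric inequality survives a pointwise supremum, because a supremum commutes with \<open>max\<close>,
  and definiteness is inherited from any single lower envelope. Hyperconvexity follows.

  Injectivity comes from the same supremum. Given a 1-Lipschitz map \<open>f\<close> on a nonempty subset \<open>A\<close> of
  \<open>Y\<close>, the balls about \<open>f a\<close> of radius \<open>d a y\<close> satisfy the condition above (triangle inequality),
  and the McShane-type formula \<open>g y = (SUP a\<in>A. exp (- d a y) * f a)\<close> picks a point in all of them.
  As this choice is explicit, its dependence on \<open>y\<close> can be read off: replacing \<open>y\<close> by \<open>z\<close> changes
  each factor, hence the supremum, by a factor of at most \<open>exp (d y z)\<close>. So all points of \<open>Y\<close> are
  treated at once, where hyperconvexity alone would call for a transfinite extension point by point.
\<close>

section \<open>Multiplicative description of the sup distance\<close>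

lemma abs_ln_divide_le_iff:
  fixes a b r :: real
  assumes "0 < a" "0 < b"
  shows "\<bar>ln (a / b)\<bar> \<le> r \<longleftrightarrow> a \<le> exp r * b \<and> b \<le> exp r * a"
proof -
  have "ln x \<le> r + ln y \<longleftrightarrow> x \<le> exp r * y" if "0 < x" "0 < y" for x y :: real
  proof -
    have "ln x \<le> ln (exp r * y) \<longleftrightarrow> x \<le> exp r * y"
      using that by (intro ln_le_cancel_iff) auto
    then show ?thesis
      using that by (simp add: ln_mult)
  qed
  from this[of a b] this[of b a] show ?thesis
    using assms by (auto simp: ln_divide_pos abs_le_iff)
qed

lemma exp_minus_mult_le_iff: "exp (- r) * a \<le> b \<longleftrightarrow> a \<le> exp r * b" for a b r :: real
  by (simp add: exp_minus field_simps)

lemma d_infty_commute: "d_infty \<alpha> \<beta> = d_infty \<beta> \<alpha>"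
  unfolding d_infty_def by (intro SUP_cong refl) (auto simp: ln_div)

locale valued_vector_space = vector_space scale
  for scale :: "'e::field \<Rightarrow> 'v::ab_group_add \<Rightarrow> 'v" +
  fixes absE :: "'e \<Rightarrow> real"
  assumes nonarch: "nonarch_abs absE"
begin

lemma absE_zero: "absE 0 = 0"
  and absE_nonneg: "0 \<le> absE c"
  and absE_mult: "absE (c * d) = absE c * absE d"
  and absE_eq_0_iff: "absE c = 0 \<longleftrightarrow> c = 0"
  using nonarch by (auto simp: nonarch_abs_def)

lemma absE_inverse:
  assumes "c \<noteq> 0"
  shows "absE c * absE (inverse c) = 1"
proof -
  have "absE 1 * absE 1 = absE 1" "absE 1 \<noteq> 0"
    by (simp_all add: absE_eq_0_iff flip: absE_mult)
  then have "absE 1 = 1"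
    by simp
  then show ?thesis
    using assms by (simp flip: absE_mult)
qed

lemma norm_at_zero: "is_norm absE scale \<alpha> \<Longrightarrow> \<alpha> 0 = 0"
  unfolding is_norm_def by (metis absE_zero mult_zero_left scale_zero_left)

lemma norm_pos: "is_norm absE scale \<alpha> \<Longrightarrow> v \<noteq> 0 \<Longrightarrow> 0 < \<alpha> v"
  unfolding is_norm_def by (metis order_le_less)

lemma d_infty_le_iff:
  assumes "is_norm absE scale \<alpha>" "is_norm absE scale \<beta>" "0 \<le> r"
  shows "d_infty \<alpha> \<beta> \<le> ennreal r \<longleftrightarrow> (\<forall>v. \<alpha> v \<le> exp r * \<beta> v \<and> \<beta> v \<le> exp r * \<alpha> v)"
proof -
  have "d_infty \<alpha> \<beta> \<le> ennreal r \<longleftrightarrow> (\<forall>v. v \<noteq> 0 \<longrightarrow> \<bar>ln (\<alpha> v / \<beta> v)\<bar> \<le> r)"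
    unfolding d_infty_def SUP_le_iff using assms(3) by auto
  also have "\<dots> \<longleftrightarrow> (\<forall>v. v \<noteq> 0 \<longrightarrow> \<alpha> v \<le> exp r * \<beta> v \<and> \<beta> v \<le> exp r * \<alpha> v)"
    using assms by (simp add: abs_ln_divide_le_iff norm_pos)
  also have "\<dots> \<longleftrightarrow> (\<forall>v. \<alpha> v \<le> exp r * \<beta> v \<and> \<beta> v \<le> exp r * \<alpha> v)"
    using assms by (metis norm_at_zero mult_zero_right order_refl)
  finally show ?thesis .
qed

lemma d_infty_triangle:
  assumes "is_norm absE scale \<alpha>" "is_norm absE scale \<beta>" "is_norm absE scale \<gamma>"
  shows "d_infty \<alpha> \<gamma> \<le> d_infty \<alpha> \<beta> + d_infty \<beta> \<gamma>"
  unfolding d_infty_def[of \<alpha> \<gamma>]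
proof (rule SUP_least)
  fix v :: 'v
  assume v: "v \<in> UNIV - {0}"
  then have pos: "0 < \<alpha> v" "0 < \<beta> v" "0 < \<gamma> v"
    using assms by (auto intro: norm_pos)
  have "ennreal \<bar>ln (\<alpha> v / \<gamma> v)\<bar> \<le> ennreal (\<bar>ln (\<alpha> v / \<beta> v)\<bar> + \<bar>ln (\<beta> v / \<gamma> v)\<bar>)"
    using pos by (intro ennreal_leI) (simp add: ln_divide_pos)
  also have "\<dots> = ennreal \<bar>ln (\<alpha> v / \<beta> v)\<bar> + ennreal \<bar>ln (\<beta> v / \<gamma> v)\<bar>"
    by simp
  also have "\<dots> \<le> d_infty \<alpha> \<beta> + d_infty \<beta> \<gamma>"
    unfolding d_infty_def by (intro add_mono SUP_upper v)
  finally show "ennreal \<bar>ln (\<alpha> v / \<gamma> v)\<bar> \<le> d_infty \<alpha> \<beta> + d_infty \<beta> \<gamma>" .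
qed

section \<open>The metric space of norms at finite distance from a given norm\<close>

lemma norm_component_is_norm: "\<alpha> \<in> norm_component absE scale \<alpha>\<^sub>0 \<Longrightarrow> is_norm absE scale \<alpha>"
  by (simp add: norm_component_def)

lemma base_in_norm_component:
  assumes "is_norm absE scale \<alpha>\<^sub>0"
  shows "\<alpha>\<^sub>0 \<in> norm_component absE scale \<alpha>\<^sub>0"
proof -
  have "d_infty \<alpha>\<^sub>0 \<alpha>\<^sub>0 \<le> ennreal 0"
    using assms by (simp only: d_infty_le_iff) simp
  then show ?thesis
    using assms by (simp add: norm_component_def)
qed

lemma norm_component_extend:
  assumes "is_norm absE scale \<alpha>\<^sub>0" "\<alpha> \<in> norm_component absE scale \<alpha>\<^sub>0"
    and "is_norm absE scale \<beta>" "d_infty \<beta> \<alpha> < \<infinity>"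
  shows "\<beta> \<in> norm_component absE scale \<alpha>\<^sub>0"
proof -
  have "d_infty \<beta> \<alpha>\<^sub>0 \<le> d_infty \<beta> \<alpha> + d_infty \<alpha> \<alpha>\<^sub>0"
    using assms by (intro d_infty_triangle) (auto intro: norm_component_is_norm)
  also have "\<dots> < \<infinity>"
    using assms by (simp add: norm_component_def)
  finally show ?thesis
    using assms by (simp add: norm_component_def)
qed

lemma d_infty_eq_norm_dist:
  assumes "is_norm absE scale \<alpha>\<^sub>0"
    and "\<alpha> \<in> norm_component absE scale \<alpha>\<^sub>0" "\<beta> \<in> norm_component absE scale \<alpha>\<^sub>0"
  shows "d_infty \<alpha> \<beta> = ennreal (norm_dist \<alpha> \<beta>)"
proof -
  have "d_infty \<alpha> \<beta> \<le> d_infty \<alpha> \<alpha>\<^sub>0 + d_infty \<beta> \<alpha>\<^sub>0"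
    using assms d_infty_triangle[of \<alpha> \<alpha>\<^sub>0 \<beta>] by (simp add: norm_component_def d_infty_commute)
  also have "\<dots> < \<infinity>"
    using assms by (simp add: norm_component_def)
  finally show ?thesis
    by (simp add: norm_dist_def)
qed

lemma norm_dist_le_iff:
  assumes "is_norm absE scale \<alpha>\<^sub>0"
    and "\<alpha> \<in> norm_component absE scale \<alpha>\<^sub>0" "\<beta> \<in> norm_component absE scale \<alpha>\<^sub>0" "0 \<le> r"
  shows "norm_dist \<alpha> \<beta> \<le> r \<longleftrightarrow> (\<forall>v. \<alpha> v \<le> exp r * \<beta> v \<and> \<beta> v \<le> exp r * \<alpha> v)"
  using d_infty_le_iff[of \<alpha> \<beta> r] d_infty_eq_norm_dist[OF assms(1-3)] assms
  by (simp add: norm_component_is_norm)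

lemma Metric_space_norm_component:
  assumes \<alpha>\<^sub>0: "is_norm absE scale \<alpha>\<^sub>0"
  shows "Metric_space (norm_component absE scale \<alpha>\<^sub>0) norm_dist"
proof
  show nonneg: "0 \<le> norm_dist \<alpha> \<beta>" for \<alpha> \<beta> :: "'v \<Rightarrow> real"
    by (simp add: norm_dist_def)
  show "norm_dist \<alpha> \<beta> = norm_dist \<beta> \<alpha>" for \<alpha> \<beta> :: "'v \<Rightarrow> real"
    by (simp add: norm_dist_def d_infty_commute)
  fix \<alpha> \<beta> \<gamma>
  assume in_comp: "\<alpha> \<in> norm_component absE scale \<alpha>\<^sub>0" "\<beta> \<in> norm_component absE scale \<alpha>\<^sub>0"
  have "norm_dist \<alpha> \<beta> = 0 \<longleftrightarrow> norm_dist \<alpha> \<beta> \<le> 0"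
    using nonneg[of \<alpha> \<beta>] by linarith
  also have "\<dots> \<longleftrightarrow> \<alpha> = \<beta>"
    using norm_dist_le_iff[OF \<alpha>\<^sub>0 in_comp, of 0] by (auto simp: fun_eq_iff intro: order_antisym)
  finally show "norm_dist \<alpha> \<beta> = 0 \<longleftrightarrow> \<alpha> = \<beta>" .
  assume \<gamma>: "\<gamma> \<in> norm_component absE scale \<alpha>\<^sub>0"
  have "ennreal (norm_dist \<alpha> \<gamma>) \<le> ennreal (norm_dist \<alpha> \<beta>) + ennreal (norm_dist \<beta> \<gamma>)"
    using d_infty_triangle[of \<alpha> \<beta> \<gamma>] in_comp \<gamma> \<alpha>\<^sub>0
    by (simp add: norm_component_is_norm flip: d_infty_eq_norm_dist)
  also have "\<dots> = ennreal (norm_dist \<alpha> \<beta> + norm_dist \<beta> \<gamma>)"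
    by (simp add: nonneg)
  finally show "norm_dist \<alpha> \<gamma> \<le> norm_dist \<alpha> \<beta> + norm_dist \<beta> \<gamma>"
    by (subst (asm) ennreal_le_iff) (simp_all add: nonneg)
qed

section \<open>The supremum of the lower envelopes\<close>

context
  fixes I :: "'i set" and \<alpha> :: "'i \<Rightarrow> 'v \<Rightarrow> real" and r :: "'i \<Rightarrow> real"
  assumes nonempty: "I \<noteq> {}"
    and norms: "\<And>i. i \<in> I \<Longrightarrow> is_norm absE scale (\<alpha> i)"
    and compatible: "\<And>i j v. i \<in> I \<Longrightarrow> j \<in> I \<Longrightarrow> \<alpha> i v \<le> exp (r i + r j) * \<alpha> j v"
begin

lemma lower_envelope_le_upper:
  assumes "i \<in> I" "j \<in> I"
  shows "exp (- r i) * \<alpha> i v \<le> exp (r j) * \<alpha> j v"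
  using compatible[OF assms, of v] by (simp add: exp_minus_mult_le_iff exp_add mult.assoc)

lemma bdd_above_lower_envelopes: "bdd_above ((\<lambda>i. exp (- r i) * \<alpha> i v) ` I)"
  using nonempty lower_envelope_le_upper by (meson bdd_aboveI2 ex_in_conv)

lemma lower_envelope_le_sup: "i \<in> I \<Longrightarrow> exp (- r i) * \<alpha> i v \<le> (SUP i\<in>I. exp (- r i) * \<alpha> i v)"
  by (intro cSUP_upper bdd_above_lower_envelopes)

lemma sup_le_upper_envelope: "j \<in> I \<Longrightarrow> (SUP i\<in>I. exp (- r i) * \<alpha> i v) \<le> exp (r j) * \<alpha> j v"
  using nonempty lower_envelope_le_upper by (intro cSUP_least)

lemma sup_within_envelopes:
  assumes "i \<in> I"
  shows "\<alpha> i v \<le> exp (r i) * (SUP i\<in>I. exp (- r i) * \<alpha> i v)"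
    and "(SUP i\<in>I. exp (- r i) * \<alpha> i v) \<le> exp (r i) * \<alpha> i v"
  using lower_envelope_le_sup[OF assms, of v] sup_le_upper_envelope[OF assms, of v]
  by (simp_all add: exp_minus_mult_le_iff)

text \<open>
  A supremum of ultrametric seminorms is one wherever it is finite, as
  \<open>sup\<^sub>i max (x\<^sub>i, y\<^sub>i) = max (sup\<^sub>i x\<^sub>i, sup\<^sub>i y\<^sub>i)\<close>; definiteness comes from a single member of
  the family.
\<close>
lemma is_norm_sup_envelope: "is_norm absE scale (\<lambda>v. SUP i\<in>I. exp (- r i) * \<alpha> i v)"
  (is "is_norm _ _ ?\<beta>")
proof -
  obtain i\<^sub>0 where i\<^sub>0: "i\<^sub>0 \<in> I"
    using nonempty by blast
  have nonneg: "0 \<le> ?\<beta> v" for v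
    using norms[OF i\<^sub>0] lower_envelope_le_sup[OF i\<^sub>0, of v]
    by (auto simp: is_norm_def intro: order_trans[rotated])
  have scale_le: "?\<beta> (scale c v) \<le> absE c * ?\<beta> v" for c v
  proof (rule cSUP_least[OF nonempty])
    fix i assume i: "i \<in> I"
    have "exp (- r i) * \<alpha> i (scale c v) = absE c * (exp (- r i) * \<alpha> i v)"
      using norms[OF i] by (simp add: is_norm_def)
    also have "\<dots> \<le> absE c * ?\<beta> v"
      by (intro mult_left_mono lower_envelope_le_sup i absE_nonneg)
    finally show "exp (- r i) * \<alpha> i (scale c v) \<le> absE c * ?\<beta> v" .
  qed
  \<comment> \<open>Applied to the inverse scalar, the inequality just obtained yields its own converse.\<close>
  have scale_ge: "absE c * ?\<beta> v \<le> ?\<beta> (scale c v)" for c v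
  proof (cases "c = 0")
    case True
    then show ?thesis
      using nonneg[of "scale c v"] by (simp add: absE_zero)
  next
    case False
    have "absE c * ?\<beta> v = absE c * ?\<beta> (scale (inverse c) (scale c v))"
      using False by simp
    also have "\<dots> \<le> absE c * (absE (inverse c) * ?\<beta> (scale c v))"
      by (intro mult_left_mono scale_le absE_nonneg)
    also have "\<dots> = ?\<beta> (scale c v)"
      using False by (simp add: absE_inverse flip: mult.assoc)
    finally show ?thesis .
  qed
  have ultrametric: "?\<beta> (v + w) \<le> max (?\<beta> v) (?\<beta> w)" for v w
  proof (rule cSUP_least[OF nonempty])
    fix i assume i: "i \<in> I"
    have "exp (- r i) * \<alpha> i (v + w) \<le> exp (- r i) * max (\<alpha> i v) (\<alpha> i w)"
      using norms[OF i] by (simp add: is_norm_def)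
    also have "\<dots> = max (exp (- r i) * \<alpha> i v) (exp (- r i) * \<alpha> i w)"
      by (simp add: max_mult_distrib_left)
    also have "\<dots> \<le> max (?\<beta> v) (?\<beta> w)"
      by (intro max.mono lower_envelope_le_sup i)
    finally show "exp (- r i) * \<alpha> i (v + w) \<le> max (?\<beta> v) (?\<beta> w)" .
  qed
  have definite: "v = 0" if "?\<beta> v = 0" for v
  proof -
    have "\<alpha> i\<^sub>0 v \<le> 0"
      using sup_within_envelopes(1)[OF i\<^sub>0, of v] unfolding that by simp
    then show ?thesis
      using norm_pos[OF norms[OF i\<^sub>0], of v] by force
  qed
  show ?thesis
    unfolding is_norm_def using nonneg order_antisym[OF scale_le scale_ge] ultrametric definite
    by blast
qed

end

text \<open>
  Membership in the component of \<open>\<alpha>\<^sub>0\<close> is automatic, the supremum being at distance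
  at most \<open>r\<^sub>i\<close> from the \<open>i\<close>-th centre.
\<close>
lemma sup_envelope_in_balls:
  assumes \<alpha>\<^sub>0: "is_norm absE scale \<alpha>\<^sub>0" and nonempty: "I \<noteq> {}"
    and centres: "\<And>i. i \<in> I \<Longrightarrow> \<alpha> i \<in> norm_component absE scale \<alpha>\<^sub>0"
    and radii: "\<And>i. i \<in> I \<Longrightarrow> 0 \<le> r i"
    and dist: "\<And>i j. i \<in> I \<Longrightarrow> j \<in> I \<Longrightarrow> norm_dist (\<alpha> i) (\<alpha> j) \<le> r i + r j"
  defines "\<beta> \<equiv> \<lambda>v. SUP i\<in>I. exp (- r i) * \<alpha> i v"
  shows "bdd_above ((\<lambda>i. exp (- r i) * \<alpha> i v) ` I)"
    and "is_norm absE scale \<beta>"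
    and "\<beta> \<in> norm_component absE scale \<alpha>\<^sub>0"
    and "i \<in> I \<Longrightarrow> norm_dist (\<alpha> i) \<beta> \<le> r i"
proof -
  have norms: "is_norm absE scale (\<alpha> i)" if "i \<in> I" for i
    using centres[OF that] by (rule norm_component_is_norm)
  have compatible: "\<alpha> i v \<le> exp (r i + r j) * \<alpha> j v" if "i \<in> I" "j \<in> I" for i j v
    using dist[OF that] radii that norm_dist_le_iff[OF \<alpha>\<^sub>0 centres centres, of i j "r i + r j"]
    by simp
  show "bdd_above ((\<lambda>i. exp (- r i) * \<alpha> i v) ` I)"
    using nonempty norms compatible by (rule bdd_above_lower_envelopes)
  show \<beta>: "is_norm absE scale \<beta>"
    unfolding \<beta>_def using nonempty norms compatible by (rule is_norm_sup_envelope)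
  have envelopes: "\<alpha> i v \<le> exp (r i) * \<beta> v" "\<beta> v \<le> exp (r i) * \<alpha> i v" if "i \<in> I" for i v
    unfolding \<beta>_def using sup_within_envelopes[OF nonempty norms compatible that] by auto
  obtain i\<^sub>0 where i\<^sub>0: "i\<^sub>0 \<in> I"
    using nonempty by blast
  have "d_infty \<beta> (\<alpha> i\<^sub>0) \<le> ennreal (r i\<^sub>0)"
    using envelopes[OF i\<^sub>0] d_infty_le_iff[OF \<beta> norms radii] i\<^sub>0 by blast
  then have "d_infty \<beta> (\<alpha> i\<^sub>0) < \<infinity>"
    by (simp add: order_le_less_trans)
  then show \<beta>_in: "\<beta> \<in> norm_component absE scale \<alpha>\<^sub>0"
    using norm_component_extend[OF \<alpha>\<^sub>0 centres[OF i\<^sub>0] \<beta>] by blast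
  show "norm_dist (\<alpha> i) \<beta> \<le> r i" if "i \<in> I"
    using envelopes[OF that] norm_dist_le_iff[OF \<alpha>\<^sub>0 centres[OF that] \<beta>_in radii[OF that]] by blast
qed

section \<open>Hyperconvexity and injectivity\<close>

theorem hyperconvex_norm_component:
  assumes \<alpha>\<^sub>0: "is_norm absE scale \<alpha>\<^sub>0"
  shows "hyperconvex_space (norm_component absE scale \<alpha>\<^sub>0) norm_dist"
  unfolding hyperconvex_space_def
proof (intro conjI allI impI)
  show M: "Metric_space (norm_component absE scale \<alpha>\<^sub>0) norm_dist"
    using \<alpha>\<^sub>0 by (rule Metric_space_norm_component)
  then interpret Metric_space "norm_component absE scale \<alpha>\<^sub>0" norm_dist .
  fix \<B> :: "(('v \<Rightarrow> real) \<times> real) set"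
  assume "(\<forall>(x, r)\<in>\<B>. x \<in> norm_component absE scale \<alpha>\<^sub>0 \<and> 0 \<le> r) \<and>
    (\<forall>(x, r)\<in>\<B>. \<forall>(y, s)\<in>\<B>. norm_dist x y \<le> r + s)"
  then have balls: "\<And>b. b \<in> \<B> \<Longrightarrow> fst b \<in> norm_component absE scale \<alpha>\<^sub>0"
      "\<And>b. b \<in> \<B> \<Longrightarrow> 0 \<le> snd b"
      "\<And>b c. b \<in> \<B> \<Longrightarrow> c \<in> \<B> \<Longrightarrow> norm_dist (fst b) (fst c) \<le> snd b + snd c"
    by fastforce+
  show "\<exists>z\<in>norm_component absE scale \<alpha>\<^sub>0. \<forall>(x, r)\<in>\<B>. z \<in> mcball x r"
  proof (cases "\<B> = {}")
    case True
    then show ?thesis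
      using base_in_norm_component[OF \<alpha>\<^sub>0] by auto
  next
    case False
    note sup = sup_envelope_in_balls[of \<alpha>\<^sub>0 \<B> fst snd, OF \<alpha>\<^sub>0 False balls]
    show ?thesis
    proof (intro bexI ballI)
      show in_comp: "(\<lambda>v. SUP b\<in>\<B>. exp (- snd b) * fst b v) \<in> norm_component absE scale \<alpha>\<^sub>0"
        by (rule sup(3))
      fix b assume b: "b \<in> \<B>"
      then have "norm_dist (fst b) (\<lambda>v. SUP b\<in>\<B>. exp (- snd b) * fst b v) \<le> snd b"
        by (intro sup(4))
      then show "case b of (x, r) \<Rightarrow> (\<lambda>v. SUP b\<in>\<B>. exp (- snd b) * fst b v) \<in> mcball x r"
        using balls(1)[OF b] in_comp by (simp add: case_prod_beta)
    qed
  qed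
qed

text \<open>
  Hyperconvexity yields a common point of the balls of radius \<open>dY a y\<close> about \<open>f a\<close> for one new point
  \<open>y\<close> at a time; the explicit supremum depends on \<open>y\<close> in a 1-Lipschitz way, so it extends \<open>f\<close> to all
  of \<open>Y\<close> at once. It does extend \<open>f\<close>, since the ball about \<open>f a\<close> has radius zero at \<open>y = a\<close>.
\<close>
theorem injective_norm_component:
  assumes \<alpha>\<^sub>0: "is_norm absE scale \<alpha>\<^sub>0"
  shows "injective_space TYPE('t) (norm_component absE scale \<alpha>\<^sub>0) norm_dist"
  unfolding injective_space_def
proof (intro conjI allI impI)
  show M: "Metric_space (norm_component absE scale \<alpha>\<^sub>0) norm_dist"
    using \<alpha>\<^sub>0 by (rule Metric_space_norm_component)
  interpret N: Metric_space "norm_component absE scale \<alpha>\<^sub>0" norm_dist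
    by (rule M)
  fix Y :: "'t set" and dY A and f :: "'t \<Rightarrow> 'v \<Rightarrow> real"
  assume asm: "Metric_space Y dY \<and> A \<subseteq> Y \<and> f \<in> A \<rightarrow> norm_component absE scale \<alpha>\<^sub>0 \<and>
    one_lipschitz_on A dY norm_dist f"
  then interpret Y: Metric_space Y dY
    by blast
  have A: "A \<subseteq> Y" and f: "\<And>a. a \<in> A \<Longrightarrow> f a \<in> norm_component absE scale \<alpha>\<^sub>0"
    and lipschitz: "\<And>a b. a \<in> A \<Longrightarrow> b \<in> A \<Longrightarrow> norm_dist (f a) (f b) \<le> dY a b"
    using asm by (auto simp: one_lipschitz_on_def)
  show "\<exists>g. g \<in> Y \<rightarrow> norm_component absE scale \<alpha>\<^sub>0 \<and> one_lipschitz_on Y dY norm_dist g \<and>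
    (\<forall>x\<in>A. g x = f x)"
  proof (cases "A = {}")
    case True
    then show ?thesis
      using base_in_norm_component[OF \<alpha>\<^sub>0]
      by (intro exI[of _ "\<lambda>_. \<alpha>\<^sub>0"]) (auto simp: one_lipschitz_on_def)
  next
    case False
    define g where "g y = (\<lambda>v. SUP a\<in>A. exp (- dY a y) * f a v)" for y
    have dist: "norm_dist (f a) (f b) \<le> dY a y + dY b y" if "a \<in> A" "b \<in> A" "y \<in> Y" for a b y
      using lipschitz[OF that(1,2)] Y.triangle'[of a y b] that A by force
    have bdd: "bdd_above ((\<lambda>a. exp (- dY a y) * f a v) ` A)" if "y \<in> Y" for y v
      by (rule sup_envelope_in_balls(1)[OF \<alpha>\<^sub>0 False f Y.nonneg dist[OF _ _ that]])
    have g_in: "g y \<in> norm_component absE scale \<alpha>\<^sub>0" if "y \<in> Y" for y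
      unfolding g_def
      by (rule sup_envelope_in_balls(3)[OF \<alpha>\<^sub>0 False f Y.nonneg dist[OF _ _ that]])
    have g_ball: "norm_dist (f a) (g y) \<le> dY a y" if "a \<in> A" "y \<in> Y" for a y
      unfolding g_def
      by (rule sup_envelope_in_balls(4)[OF \<alpha>\<^sub>0 False f Y.nonneg dist[OF _ _ that(2)] that(1)])
    have g_le: "g y v \<le> exp (dY y z) * g z v" if "y \<in> Y" "z \<in> Y" for y z v
      unfolding g_def[of y]
    proof (rule cSUP_least[OF False])
      fix a assume a: "a \<in> A"
      have "0 \<le> f a v"
        using norm_component_is_norm[OF f[OF a]] by (simp add: is_norm_def)
      moreover have "- dY a y \<le> dY y z - dY a z"
        using Y.triangle[of a y z] a A that by force
      ultimately have "exp (- dY a y) * f a v \<le> exp (dY y z - dY a z) * f a v"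
        by (intro mult_right_mono) simp_all
      also have "\<dots> = exp (dY y z) * (exp (- dY a z) * f a v)"
        by (simp add: mult.assoc flip: exp_add)
      also have "\<dots> \<le> exp (dY y z) * g z v"
        unfolding g_def by (intro mult_left_mono cSUP_upper a bdd that) auto
      finally show "exp (- dY a y) * f a v \<le> exp (dY y z) * g z v" .
    qed
    have "one_lipschitz_on Y dY norm_dist g"
      unfolding one_lipschitz_on_def
    proof (intro ballI)
      fix y z assume yz: "y \<in> Y" "z \<in> Y"
      show "norm_dist (g y) (g z) \<le> dY y z"
        unfolding norm_dist_le_iff[OF \<alpha>\<^sub>0 g_in[OF yz(1)] g_in[OF yz(2)] Y.nonneg]
        using g_le[OF yz] g_le[OF yz(2,1)] Y.commute[of z y] by simp
    qed
    moreover have "g a = f a" if "a \<in> A" for a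
    proof -
      have "a \<in> Y"
        using that A by blast
      then have "norm_dist (f a) (g a) \<le> 0"
        using g_ball[OF that, of a] by simp
      then show ?thesis
        using N.mdist_pos_less[OF _ f[OF that] g_in[OF \<open>a \<in> Y\<close>]] by (metis not_le)
    qed
    ultimately show ?thesis
      using g_in by blast
  qed
qed

end

theorem theorem4p3:
  fixes p :: nat
    and absQ :: "'q::field_char_0 \<Rightarrow> real"
    and iF :: "'q \<Rightarrow> 'f::field" and absF :: "'f \<Rightarrow> real"
    and iE :: "'q \<Rightarrow> 'e::field" and absE :: "'e \<Rightarrow> real"
    and P :: "('n::finite \<times> 'n, 'f) mvpoly set"
    and G :: "('f ^ 'n ^ 'n) set"
    and sX :: "'e \<Rightarrow> 'x::ab_group_add \<Rightarrow> 'x" and \<pi> :: "'f ^ 'n ^ 'n \<Rightarrow> 'x \<Rightarrow> 'x"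
    and sY :: "'e \<Rightarrow> 'y::ab_group_add \<Rightarrow> 'y" and \<sigma> :: "'f ^ 'n ^ 'n \<Rightarrow> 'y \<Rightarrow> 'y"
    and sV :: "'e \<Rightarrow> 'v::ab_group_add \<Rightarrow> 'v" and \<rho> :: "'f ^ 'n ^ 'n \<Rightarrow> 'v \<Rightarrow> 'v"
    and t :: "'x \<Rightarrow> 'y \<Rightarrow> 'v"
    and \<alpha>\<^sub>0 :: "'v \<Rightarrow> real"
  assumes Qp: "is_padic_field p absQ"
    and F: "finite_field_ext iF" "nonarch_abs absF" "\<forall>x. absF (iF x) = absQ x"
    and E: "finite_field_ext iE" "nonarch_abs absE" "nontrivial_abs absE"
    and reductive: "reductive_group P"
    and G: "G = points id P"
    and smooth: "smooth_representation absF sX G \<pi>"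
    and admissible: "admissible_representation absF sX G \<pi>"
    and algebraic: "algebraic_representation iF iE P sY \<sigma>"
    and tensor: "is_tensor_product sX sY sV t"
    and diagonal: "diagonal_action sV t G \<pi> \<sigma> \<rho>"
    and norm: "is_norm absE sV \<alpha>\<^sub>0"
  shows "hyperconvex_space (norm_component absE sV \<alpha>\<^sub>0) norm_dist \<and>
    (\<forall>(I :: 'i set) (\<alpha> :: 'i \<Rightarrow> 'v \<Rightarrow> real) (r :: 'i \<Rightarrow> real).
       I \<noteq> {} \<and>
       (\<forall>i\<in>I. \<alpha> i \<in> norm_component absE sV \<alpha>\<^sub>0 \<and> 0 \<le> r i) \<and>
       (\<forall>i\<in>I. \<forall>j\<in>I. d_infty (\<alpha> i) (\<alpha> j) \<le> ennreal (r i + r j))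
       \<longrightarrow>
       (let \<beta> = (\<lambda>v. SUP i\<in>I. exp (- r i) * \<alpha> i v) in
          (\<forall>v. bdd_above ((\<lambda>i. exp (- r i) * \<alpha> i v) ` I)) \<and>
          is_norm absE sV \<beta> \<and>
          (\<forall>i\<in>I. \<beta> \<in> Metric_space.mcball (norm_component absE sV \<alpha>\<^sub>0) norm_dist (\<alpha> i) (r i)))) \<and>
    injective_space TYPE('t) (norm_component absE sV \<alpha>\<^sub>0) norm_dist"
proof -
  interpret valued_vector_space sV absE
    using tensor E(2)
    by (simp add: is_tensor_product_def valued_vector_space_def valued_vector_space_axioms_def)
  interpret N: Metric_space "norm_component absE sV \<alpha>\<^sub>0" norm_dist
    using norm by (rule Metric_space_norm_component)
  show ?thesis
    unfolding Let_def
  proof (intro conjI hyperconvex_norm_component injective_norm_component norm allI impI)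
    fix I :: "'i set" and \<alpha> :: "'i \<Rightarrow> 'v \<Rightarrow> real" and r :: "'i \<Rightarrow> real"
    assume asm: "I \<noteq> {} \<and> (\<forall>i\<in>I. \<alpha> i \<in> norm_component absE sV \<alpha>\<^sub>0 \<and> 0 \<le> r i) \<and>
      (\<forall>i\<in>I. \<forall>j\<in>I. d_infty (\<alpha> i) (\<alpha> j) \<le> ennreal (r i + r j))"
    then have centres: "\<And>i. i \<in> I \<Longrightarrow> \<alpha> i \<in> norm_component absE sV \<alpha>\<^sub>0"
      and radii: "\<And>i. i \<in> I \<Longrightarrow> 0 \<le> r i" and nonempty: "I \<noteq> {}"
      by auto
    have dist: "norm_dist (\<alpha> i) (\<alpha> j) \<le> r i + r j" if "i \<in> I" "j \<in> I" for i j
      unfolding norm_dist_def using asm that radii by (intro enn2real_leI) auto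
    note sup = sup_envelope_in_balls[of \<alpha>\<^sub>0 I \<alpha> r, OF norm nonempty centres radii dist]
    show "bdd_above ((\<lambda>i. exp (- r i) * \<alpha> i v) ` I)" for v
      by (rule sup(1))
    show "is_norm absE sV (\<lambda>v. SUP i\<in>I. exp (- r i) * \<alpha> i v)"
      by (rule sup(2))
    show "\<forall>i\<in>I. (\<lambda>v. SUP i\<in>I. exp (- r i) * \<alpha> i v) \<in> N.mcball (\<alpha> i) (r i)"
    proof
      fix i assume i: "i \<in> I"
      have "norm_dist (\<alpha> i) (\<lambda>v. SUP i\<in>I. exp (- r i) * \<alpha> i v) \<le> r i"
        by (rule sup(4)[OF _ _ _ _ i])
      moreover have "(\<lambda>v. SUP i\<in>I. exp (- r i) * \<alpha> i v) \<in> norm_component absE sV \<alpha>\<^sub>0"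
        by (rule sup(3))
      ultimately show "(\<lambda>v. SUP i\<in>I. exp (- r i) * \<alpha> i v) \<in> N.mcball (\<alpha> i) (r i)"
        using centres[OF i] by simp
    qed
  qed
qed

end
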